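(* Let $d\ge 1$, $M>0$, let $D\subset\mathbb Z^d$ be a Delone set (i.e. an $R$-Delone set for some $R\ge 1$), and let $$\tilde H_0=\Delta+4d+M\sum_{n\in\mathbb Z^d\setminus D}\delta_n\quad\text{on }\ell^2(\mathbb Z^d).$$ If $D$ has the property of strict uniform pattern frequency, then the spectrum of $\tilde H_0$ is essential spectrum, i.e. $\sigma(\tilde H_0)=\sigma_{ess}(\tilde H_0)$.
   Context: **Delone sets.** For a constant $R\ge 1$, a subset $D\subset\mathbb Z^d$ is an $R$-Delone set in $\mathbb Z^d$ if every closed cube in $\mathbb Z^d$ of side length $R$ in the max-norm contains at least one point of $D$. **Strict uniform pattern frequency.** Any finite subset $Q\subset D$ is called a pattern of $D$; two sets $Q,Q'\subset D$ are equivalent if $x+Q=Q'$ for some $x\in\mathbb Z^d$. Let $(\Lambda_L)_{L\in\mathbb N}$ be a sequence of concentric cubes of side length $L$ in $\mathbb Z^d$. $D$ has uniform pattern frequency if for any pattern $Q\subset D$ the sequence $$\eta_{x,L}(Q)=\frac{\#\{\tilde Q\subset D:\ \exists\, y\in x+\Lambda_L \text{ such that } y+\tilde Q=Q\}}{|\Lambda_L|}$$ converges uniformly with respect to $x\in\mathbb Z^d$ as $L\to\infty$. It has strict uniform pattern frequency if moreover this limit is strictly positive. **Operators.** $(\Delta u)(n)=\sum_{|m-n|_1=1}(u(m)-u(n))$, where $|n|_1=\sum_i|n_i|$; $\delta_n$ denotes the Kronecker delta at $n$, and functions on $\mathbb Z^d$ act as multiplication operators.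
   Formalization: Patterns are non-empty sets D∩W for finite windows W, and an occurrence must match D exactly in the translated window; with arbitrary subsets Q of D the claim fails, e.g. for D = Z\{0}, d = 1, where an isolated simple eigenvalue appears above [0,4]. *)

theory Defs
  imports "HOL-Analysis.Analysis"
begin

section \<open>Delone sets and pattern frequency in the integer lattice\<close>

text \<open>Side lengths and centres may be real; only the points of the cube are lattice points.\<close>

definition lattice_cube :: "real ^ 'd \<Rightarrow> real \<Rightarrow> (int ^ 'd::finite) set" where
  "lattice_cube c r = {n. \<forall>i. \<bar>of_int (n $ i) - c $ i\<bar> \<le> r / 2}"

definition delone_set :: "real \<Rightarrow> (int ^ 'd::finite) set \<Rightarrow> bool" where
  "delone_set R D \<longleftrightarrow> (\<forall>c. lattice_cube c R \<inter> D \<noteq> {})"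

text \<open>A pattern of \<open>D\<close> is \<open>D \<inter> W\<close> for a finite window \<open>W\<close>. Every finite \<open>Q \<subseteq> D\<close> is of this
  form, with \<open>W = Q\<close>, but the window matters for what counts as an occurrence: the set \<open>Q'\<close> that
  is translated onto \<open>D \<inter> W\<close> has to be everything that \<open>D\<close> contains in the translated window.
  For \<open>W = Q\<close> this only says \<open>Q' \<subseteq> D\<close> (see \<open>occurrences_self_window\<close> below), so that \<open>D\<close> may have
  further points between those of \<open>Q'\<close>. Requiring strict uniform frequency for these windows only
  would be too weak: \<open>UNIV - {0}\<close> would then have the property, in which every pattern has
  frequency 1, whereas the hole at 0 never recurs. In dimension 1 it binds an eigenfunction
  \<open>\<lambda>n. a ^ nat \<bar>n $ 1\<bar>\<close>, where \<open>0 < a < 1\<close> and \<open>1 / a - a = M\<close>, with isolated simple eigenvalue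
  \<open>a + 1 / a + 2\<close> above the essential spectrum.

  \<open>lattice_cube c 0\<close>, \<open>lattice_cube c 1\<close>, \<dots> is the sequence of concentric cubes with common
  centre \<open>c\<close>, and \<open>(+) x ` A\<close> is the translate of \<open>A\<close> by \<open>x\<close>.\<close>

definition occurrences ::
    "(int ^ 'd::finite) set \<Rightarrow> (int ^ 'd) set \<Rightarrow> (int ^ 'd) set \<Rightarrow> (int ^ 'd) set set" where
  "occurrences D W Y = {Q'. \<exists>y\<in>Y. Q' = {n \<in> D. y + n \<in> W} \<and> (+) y ` Q' = D \<inter> W}"

lemma occurrences_self_window:
  assumes "Q \<subseteq> D"
  shows "occurrences D Q Y = {Q'. Q' \<subseteq> D \<and> (\<exists>y\<in>Y. (+) y ` Q' = Q)}"
  using assms unfolding occurrences_def by (auto simp: Int_absorb1)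

definition pattern_freq ::
    "real ^ 'd \<Rightarrow> (int ^ 'd::finite) set \<Rightarrow> (int ^ 'd) set \<Rightarrow> nat \<Rightarrow> int ^ 'd \<Rightarrow> real" where
  "pattern_freq c D W L x =
     real (card (occurrences D W ((+) x ` lattice_cube c (real L))))
       / real (card (lattice_cube c (real L) :: (int ^ 'd) set))"

definition uniform_pattern_frequency :: "real ^ 'd \<Rightarrow> (int ^ 'd::finite) set \<Rightarrow> bool" where
  "uniform_pattern_frequency c D \<longleftrightarrow>
     (\<forall>W. finite W \<and> D \<inter> W \<noteq> {} \<longrightarrow>
        (\<exists>\<nu>. uniform_limit UNIV (\<lambda>L x. pattern_freq c D W L x) \<nu> sequentially))"

text \<open>The empty pattern is left out because it has at most one occurrence in the sense of
  \<open>occurrences\<close>, so its frequency always tends to 0.\<close>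

definition strict_uniform_pattern_frequency :: "real ^ 'd \<Rightarrow> (int ^ 'd::finite) set \<Rightarrow> bool" where
  "strict_uniform_pattern_frequency c D \<longleftrightarrow>
     uniform_pattern_frequency c D \<and>
     (\<forall>W x. finite W \<and> D \<inter> W \<noteq> {} \<longrightarrow> lim (\<lambda>L. pattern_freq c D W L x) > 0)"

section \<open>Bounded operators on complex square-summable functions\<close>

definition ell2 :: "('a \<Rightarrow> complex) set" where
  "ell2 = {u. (\<lambda>n. (cmod (u n))\<^sup>2) summable_on UNIV}"

definition ell2_norm :: "('a \<Rightarrow> complex) \<Rightarrow> real" where
  "ell2_norm u = sqrt (\<Sum>\<^sub>\<infinity>n. (cmod (u n))\<^sup>2)"

text \<open>Operators are functions on all of \<open>'a \<Rightarrow> complex\<close>; only their restriction to \<open>ell2\<close>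
  enters the notions below.\<close>

definition bounded_op :: "(('a \<Rightarrow> complex) \<Rightarrow> ('a \<Rightarrow> complex)) \<Rightarrow> bool" where
  "bounded_op T \<longleftrightarrow>
     (\<forall>u\<in>ell2. T u \<in> ell2) \<and>
     (\<forall>u\<in>ell2. \<forall>v\<in>ell2. T (\<lambda>n. u n + v n) = (\<lambda>n. T u n + T v n)) \<and>
     (\<forall>a. \<forall>u\<in>ell2. T (\<lambda>n. a * u n) = (\<lambda>n. a * T u n)) \<and>
     (\<exists>C. \<forall>u\<in>ell2. ell2_norm (T u) \<le> C * ell2_norm u)"

definition shifted_op ::
    "(('a \<Rightarrow> complex) \<Rightarrow> ('a \<Rightarrow> complex)) \<Rightarrow> complex \<Rightarrow> ('a \<Rightarrow> complex) \<Rightarrow> ('a \<Rightarrow> complex)" where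
  "shifted_op T z u = (\<lambda>n. T u n - z * u n)"

definition resolvent_set :: "(('a \<Rightarrow> complex) \<Rightarrow> ('a \<Rightarrow> complex)) \<Rightarrow> complex set" where
  "resolvent_set T =
     {z. \<exists>S. bounded_op S \<and>
        (\<forall>u\<in>ell2. S (shifted_op T z u) = u \<and> shifted_op T z (S u) = u)}"

definition op_spectrum :: "(('a \<Rightarrow> complex) \<Rightarrow> ('a \<Rightarrow> complex)) \<Rightarrow> complex set" where
  "op_spectrum T = - resolvent_set T"

definition eigenspace ::
    "(('a \<Rightarrow> complex) \<Rightarrow> ('a \<Rightarrow> complex)) \<Rightarrow> complex \<Rightarrow> ('a \<Rightarrow> complex) set" where
  "eigenspace T z = {u \<in> ell2. T u = (\<lambda>n. z * u n)}"

definition finite_dim :: "('a \<Rightarrow> complex) set \<Rightarrow> bool" where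
  "finite_dim E \<longleftrightarrow>
     (\<exists>B. finite B \<and> B \<subseteq> E \<and> (\<forall>u\<in>E. \<exists>a. u = (\<lambda>n. \<Sum>b\<in>B. a b * b n)))"

text \<open>The definitions of discrete and essential spectrum are the usual ones for self-adjoint
  operators: the discrete spectrum consists of the isolated points of the spectrum that are
  eigenvalues of finite multiplicity, and the essential spectrum is the rest of the spectrum.\<close>

definition discrete_spectrum :: "(('a \<Rightarrow> complex) \<Rightarrow> ('a \<Rightarrow> complex)) \<Rightarrow> complex set" where
  "discrete_spectrum T =
     {z. z isolated_in op_spectrum T \<and> (\<exists>u \<in> eigenspace T z. u \<noteq> (\<lambda>n. 0)) \<and>
         finite_dim (eigenspace T z)}"

definition essential_spectrum :: "(('a \<Rightarrow> complex) \<Rightarrow> ('a \<Rightarrow> complex)) \<Rightarrow> complex set" where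
  "essential_spectrum T = op_spectrum T - discrete_spectrum T"

section \<open>The operators\<close>

definition l1_norm :: "int ^ 'd::finite \<Rightarrow> int" where
  "l1_norm n = (\<Sum>i\<in>UNIV. \<bar>n $ i\<bar>)"

lemma finite_l1_sphere: "finite {m :: int ^ 'd::finite. l1_norm (m - n) = r}"
proof (rule finite_subset)
  let ?F = "PiE UNIV (\<lambda>i. {n $ i - r .. n $ i + r})"
  show "{m. l1_norm (m - n) = r} \<subseteq> vec_lambda ` ?F"
  proof
    fix m assume "m \<in> {m. l1_norm (m - n) = r}"
    then have r: "(\<Sum>i\<in>UNIV. \<bar>m $ i - n $ i\<bar>) = r"
      by (simp add: l1_norm_def)
    have "\<bar>m $ i - n $ i\<bar> \<le> r" for i
      using member_le_sum[of i UNIV "\<lambda>i. \<bar>m $ i - n $ i\<bar>"] r by simp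
    then have "vec_nth m \<in> ?F"
      by (auto simp: PiE_iff abs_le_iff algebra_simps)
    then show "m \<in> vec_lambda ` ?F"
      by (metis image_eqI vec_nth_inverse)
  qed
  show "finite (vec_lambda ` ?F)"
    by (intro finite_imageI finite_PiE) auto
qed

definition laplacian :: "(int ^ 'd::finite \<Rightarrow> complex) \<Rightarrow> (int ^ 'd \<Rightarrow> complex)" where
  "laplacian u = (\<lambda>n. \<Sum>m | l1_norm (m - n) = 1. u m - u n)"

text \<open>The indicator function of the complement of \<open>D\<close> is the sum of the Kronecker deltas
  at the points outside \<open>D\<close>.\<close>

definition H0_tilde ::
    "(int ^ 'd::finite) set \<Rightarrow> real \<Rightarrow> (int ^ 'd \<Rightarrow> complex) \<Rightarrow> (int ^ 'd \<Rightarrow> complex)" where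
  "H0_tilde D M u =
     (\<lambda>n. laplacian u n + 4 * of_nat CARD('d) * u n
            + complex_of_real M * indicator (- D) n * u n)"

end

theory Submission
  imports Defs
begin

text \<open>Suppose \<open>z\<close> is an isolated eigenvalue of finite multiplicity \<open>m\<close>. Cut an eigenfunction off to
  a finite set. By strict uniform pattern frequency the part of \<open>D\<close> that its support sees recurs at
  infinitely many places, so \<open>m + 1\<close> translates of the cut-off function with disjoint supports are
  approximate eigenfunctions, as good as we like. The gap around \<open>z\<close> puts each of them
  close to the eigenspace, and \<open>m + 1\<close> nearly orthogonal vectors cannot lie close to a space of
  dimension \<open>m\<close>.

  The gap is exploited without the spectral theorem. For symmetric \<open>A\<close> with no spectrum in a
  punctured interval \<open>(-2r, 2r) - {0}\<close>, the numbers \<open>\<parallel>(A \<mp> r)x\<parallel>\<close> are at least \<open>r\<parallel>x\<parallel>\<close>, so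
  \<open>2r\<bar>(Ax, x)\<bar> \<le> \<parallel>Ax\<parallel>\<^sup>2\<close>. Polarizing gives \<open>2r\<parallel>Ax\<parallel> \<le> \<parallel>A\<^sup>2x\<parallel>\<close>, and solving \<open>(A - t)w = q\<close> for
  \<open>t \<rightarrow> 0\<close> then shows that \<open>q\<close> has distance at most \<open>\<parallel>Aq\<parallel> / r\<close> from the kernel of \<open>A\<close>.\<close>

section \<open>Symmetric operators with a spectral gap\<close>

text \<open>Let \<open>c\<close> be the best lower bound up to \<open>r\<close>. If
  \<open>c < r\<close>, then \<open>B - c\<close> and \<open>B + c\<close> are both bounded below,
  hence so is their product \<open>B\<^sup>2 - c\<^sup>2\<close>. Its form is nonnegative, and a
  nonnegative bounded symmetric operator that is bounded below has a form at least a positive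
  multiple of \<open>(norm x)\<^sup>2\<close>. That improves \<open>c\<close>.\<close>

lemma symmetric_bounded_below:
  fixes B :: "'b::real_inner \<Rightarrow> 'b"
  assumes lin: "bounded_linear B"
    and sym: "\<And>x y. inner (B x) y = inner x (B y)"
    and "r \<ge> 0"
    and below: "\<And>s. \<bar>s\<bar> < r \<Longrightarrow> \<exists>\<kappa>>0. \<forall>x. \<kappa> * norm x \<le> norm (B x - s *\<^sub>R x)"
  shows "r * norm x \<le> norm (B x)"
proof -
  interpret B: bounded_linear B by (rule lin)
  define C where "C = {c. 0 \<le> c \<and> c \<le> r \<and> (\<forall>x. c * norm x \<le> norm (B x))}"
  define c where "c = Sup C"
  have 0: "0 \<in> C" using \<open>r \<ge> 0\<close> by (auto simp: C_def)
  have bdd: "bdd_above C" by (auto simp: C_def intro: bdd_aboveI[of _ r])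
  have "C \<noteq> {}" "\<And>c. c \<in> C \<Longrightarrow> c \<le> r" using 0 by (auto simp: C_def)
  then have c: "0 \<le> c" "c \<le> r"
    unfolding c_def using 0 bdd by (auto intro: cSup_upper cSup_least)
  have cC: "c * norm x \<le> norm (B x)" for x
  proof (cases "x = 0")
    case False
    have "c \<le> norm (B x) / norm x"
      unfolding c_def using 0 False
      by (intro cSup_least) (auto simp: C_def pos_le_divide_eq)
    then show ?thesis using False by (simp add: pos_le_divide_eq)
  qed simp
  have "c = r"
  proof (rule ccontr)
    assume "c \<noteq> r"
    then have "c < r" using c by simp
    then obtain \<kappa>1 \<kappa>2 where \<kappa>: "\<kappa>1 > 0" "\<kappa>2 > 0"
      and k1: "\<And>x. \<kappa>1 * norm x \<le> norm (B x - c *\<^sub>R x)"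
      and k2: "\<And>x. \<kappa>2 * norm x \<le> norm (B x - (- c) *\<^sub>R x)"
      using below[of c] below[of "- c"] c by auto
    define G where "G x = B (B x) - (c * c) *\<^sub>R x" for x
    have G_factor: "G x = B (B x - (- c) *\<^sub>R x) - c *\<^sub>R (B x - (- c) *\<^sub>R x)" for x
      by (simp add: G_def B.diff B.add B.scaleR algebra_simps)
    have below_G: "\<kappa>1 * \<kappa>2 * norm x \<le> norm (G x)" for x
    proof -
      have "\<kappa>1 * (\<kappa>2 * norm x) \<le> \<kappa>1 * norm (B x - (- c) *\<^sub>R x)"
        using k2 \<kappa> by (intro mult_left_mono) auto
      also have "\<dots> \<le> norm (G x)"
        unfolding G_factor by (rule k1)
      finally show ?thesis by (simp add: mult.assoc)
    qed
    have lin_G: "bounded_linear G"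
      unfolding G_def
      by (intro bounded_linear_sub bounded_linear_compose[OF lin lin] bounded_linear_scaleR_right)
    interpret G: bounded_linear G by (rule lin_G)
    obtain K where K: "K > 0" "\<And>x. norm (G x) \<le> norm x * K"
      using G.pos_bounded by blast
    have form: "inner (G x) x = (norm (B x))\<^sup>2 - c\<^sup>2 * (norm x)\<^sup>2" for x
      by (simp add: G_def inner_diff_left sym[of "B x" x] power2_norm_eq_inner power2_eq_square[of c])
    have form_ge: "inner (G x) x \<ge> 0" for x
      using power_mono[OF cC[of x], of 2] c unfolding form by (simp add: power_mult_distrib)
    have sym_G: "inner (G x) y = inner x (G y)" for x y
      by (simp add: G_def inner_diff_left inner_diff_right sym)
    \<comment> \<open>Cauchy-Schwarz for the positive form of \<open>G\<close>, applied to \<open>x\<close> and \<open>G x\<close>\<close>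
    have norm_G: "(norm (G x))\<^sup>2 \<le> K * inner (G x) x" for x
    proof -
      define y where "y = G x"
      have "0 \<le> inner (G (x - (1 / K) *\<^sub>R y)) (x - (1 / K) *\<^sub>R y)"
        by (rule form_ge)
      also have "\<dots> = inner (G x) x - 2 / K * inner y y + 1 / K\<^sup>2 * inner (G y) y"
        using K by (simp add: G.diff G.scaleR inner_diff_left inner_diff_right sym_G[of y x]
            y_def[symmetric] power2_eq_square inner_commute[of x] field_simps)
      also have "inner (G y) y \<le> norm (G y) * norm y"
        by (rule norm_cauchy_schwarz)
      also have "\<dots> \<le> norm y * K * norm y"
        by (intro mult_right_mono K) auto
      also have "\<dots> = K * inner y y"
        by (simp add: power2_norm_eq_inner[symmetric] power2_eq_square)
      finally have "0 \<le> inner (G x) x - 2 / K * inner y y + 1 / K\<^sup>2 * (K * inner y y)"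
        using K by (simp add: mult_left_mono divide_right_mono)
      then have "0 \<le> inner (G x) x - inner y y / K"
        using K by (simp add: power2_eq_square field_simps)
      then show ?thesis
        using K by (simp add: y_def power2_norm_eq_inner field_simps)
    qed
    have "(\<kappa>1 * \<kappa>2 * norm x)\<^sup>2 \<le> K * ((norm (B x))\<^sup>2 - c\<^sup>2 * (norm x)\<^sup>2)" for x
    proof -
      have "(\<kappa>1 * \<kappa>2 * norm x)\<^sup>2 \<le> (norm (G x))\<^sup>2"
        using \<kappa> by (intro power_mono below_G) auto
      also have "\<dots> \<le> K * inner (G x) x" by (rule norm_G)
      finally show ?thesis by (simp only: form)
    qed
    then have gain: "(c\<^sup>2 + (\<kappa>1 * \<kappa>2)\<^sup>2 / K) * (norm x)\<^sup>2 \<le> (norm (B x))\<^sup>2" for x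
      using K by (simp add: field_simps power_mult_distrib)
    \<comment> \<open>The cap by \<open>r\<close> keeps \<open>c'\<close> inside \<open>C\<close>;
      since \<open>c < r\<close>, it still exceeds \<open>c\<close>.\<close>
    define c' where "c' = min r (sqrt (c\<^sup>2 + (\<kappa>1 * \<kappa>2)\<^sup>2 / K))"
    have "c < sqrt (c\<^sup>2 + (\<kappa>1 * \<kappa>2)\<^sup>2 / K)"
      using \<kappa> K c by (intro real_less_rsqrt) auto
    then have "c < c'" using \<open>c < r\<close> by (simp add: c'_def)
    have "c' * norm x \<le> norm (B x)" for x
    proof -
      have "c' * norm x \<le> sqrt (c\<^sup>2 + (\<kappa>1 * \<kappa>2)\<^sup>2 / K) * norm x"
        by (intro mult_right_mono) (auto simp: c'_def)
      also have "\<dots> = sqrt ((c\<^sup>2 + (\<kappa>1 * \<kappa>2)\<^sup>2 / K) * (norm x)\<^sup>2)"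
        by (simp add: real_sqrt_mult)
      also have "\<dots> \<le> norm (B x)"
        using real_sqrt_le_mono[OF gain[of x]] by simp
      finally show ?thesis .
    qed
    moreover have "c' \<le> r" by (simp add: c'_def)
    ultimately have "c' \<in> C"
      using \<open>c < c'\<close> c by (auto simp: C_def)
    then have "c' \<le> c" unfolding c_def using bdd by (rule cSup_upper)
    then show False using \<open>c < c'\<close> by simp
  qed
  then show ?thesis using cC by simp
qed

text \<open>Vectors \<open>A x\<close> are orthogonal to the kernel, so this expresses without
  spectral projections that \<open>A\<close> expands by \<open>2 * r\<close> away from its
  kernel.\<close>

lemma symmetric_gap_on_range:
  fixes A :: "'b::real_inner \<Rightarrow> 'b"
  assumes lin: "bounded_linear A"
    and sym: "\<And>x y. inner (A x) y = inner x (A y)"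
    and "r > 0"
    and below: "\<And>t. t \<noteq> 0 \<Longrightarrow> \<bar>t\<bar> < 2 * r \<Longrightarrow> \<exists>\<kappa>>0. \<forall>x. \<kappa> * norm x \<le> norm (A x - t *\<^sub>R x)"
  shows "2 * r * norm (A x) \<le> norm (A (A x))"
proof -
  interpret A: bounded_linear A by (rule lin)
  \<comment> \<open>The sign \<open>e\<close> picks one half of the punctured interval. Its midpoint
    \<open>e * r\<close> has distance \<open>r\<close> from both ends, the radius that
    \<open>symmetric_bounded_below\<close> needs. Squaring the bound makes the
    \<open>r\<^sup>2\<close> terms cancel.\<close>
  have half: "2 * (e * r) * inner (A x) x \<le> (norm (A x))\<^sup>2" if e: "\<bar>e\<bar> = 1" for e x
  proof -
    have "r * norm x \<le> norm (A x - (e * r) *\<^sub>R x)"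
    proof (rule symmetric_bounded_below)
      show "bounded_linear (\<lambda>x. A x - (e * r) *\<^sub>R x)"
        by (intro bounded_linear_sub lin bounded_linear_scaleR_right)
      show "inner (A x - (e * r) *\<^sub>R x) y = inner x (A y - (e * r) *\<^sub>R y)" for x y
        by (simp add: inner_diff_left inner_diff_right sym)
      fix s :: real assume s: "\<bar>s\<bar> < r"
      have "e * r + s \<noteq> 0" "\<bar>e * r + s\<bar> < 2 * r"
        using s e \<open>r > 0\<close> by (auto simp: abs_if split: if_splits)
      from below[OF this]
      show "\<exists>\<kappa>>0. \<forall>x. \<kappa> * norm x \<le> norm (A x - (e * r) *\<^sub>R x - s *\<^sub>R x)"
        by (simp add: algebra_simps)
    qed (use \<open>r > 0\<close> in auto)
    from power_mono[OF this, of 2] \<open>r > 0\<close>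
    have "r\<^sup>2 * inner x x \<le> inner (A x - (e * r) *\<^sub>R x) (A x - (e * r) *\<^sub>R x)"
      by (simp add: power_mult_distrib power2_norm_eq_inner)
    also have "\<dots> = (norm (A x))\<^sup>2 - 2 * (e * r) * inner (A x) x + \<bar>e\<bar>\<^sup>2 * r\<^sup>2 * inner x x"
      by (simp add: inner_diff_left inner_diff_right power2_norm_eq_inner power2_eq_square[of r]
          power2_eq_square[of e] inner_commute[of x "A x"] algebra_simps)
    finally show ?thesis using e by simp
  qed
  \<comment> \<open>polarization of \<open>half\<close> at \<open>x\<close> and a multiple of \<open>A x\<close>\<close>
  define w where "w = (1 / (2 * r)) *\<^sub>R A x"
  have "4 * inner (A x) w = inner (A (x + w)) (x + w) - inner (A (x - w)) (x - w)"
    by (simp add: A.add A.diff inner_add_left inner_add_right inner_diff_left inner_diff_right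
        sym[of w x] inner_commute[of w "A x"])
  then have "2 * r * (4 * inner (A x) w) =
      2 * r * (inner (A (x + w)) (x + w) - inner (A (x - w)) (x - w))"
    by (rule arg_cong)
  then have "8 * r * inner (A x) w =
      2 * r * inner (A (x + w)) (x + w) + 2 * (- 1 * r) * inner (A (x - w)) (x - w)"
    by (simp add: right_diff_distrib)
  also have "\<dots> \<le> (norm (A (x + w)))\<^sup>2 + (norm (A (x - w)))\<^sup>2"
    using half[of 1 "x + w"] half[of "-1" "x - w"] by simp
  also have "\<dots> = 2 * (norm (A x))\<^sup>2 + 2 * (norm (A w))\<^sup>2"
    by (simp add: A.add A.diff power2_norm_eq_inner inner_add_left inner_add_right
        inner_diff_left inner_diff_right)
  \<comment> \<open>By the choice of \<open>w\<close> the left side is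
    \<open>4 * (norm (A x))\<^sup>2\<close>, half of which cancels against the right side.\<close>
  finally have "(norm (A x))\<^sup>2 \<le> (norm (A w))\<^sup>2"
    using \<open>r > 0\<close> by (simp add: w_def power2_norm_eq_inner)
  then have "norm (A x) \<le> norm (A w)" by simp
  then show ?thesis
    using \<open>r > 0\<close> by (simp add: w_def A.scaleR field_simps)
qed

text \<open>The vector is \<open>q\<close> minus the limit of \<open>A (w k)\<close>, where
  \<open>w k\<close> solves the equation shifted by \<open>z k\<close>. In spectral terms that limit
  is the component of \<open>q\<close> orthogonal to the kernel.\<close>

lemma symmetric_gap_near_kernel:
  fixes A :: "'b::{real_inner, complete_space} \<Rightarrow> 'b"
  assumes lin: "bounded_linear A"
    and sym: "\<And>x y. inner (A x) y = inner x (A y)"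
    and "r > 0"
    and below: "\<And>t. t \<noteq> 0 \<Longrightarrow> \<bar>t\<bar> < 2 * r \<Longrightarrow> \<exists>\<kappa>>0. \<forall>x. \<kappa> * norm x \<le> norm (A x - t *\<^sub>R x)"
    and onto: "\<And>t. t \<noteq> 0 \<Longrightarrow> \<bar>t\<bar> < 2 * r \<Longrightarrow> surj (\<lambda>x. A x - t *\<^sub>R x)"
  obtains y where "A y = 0" "norm (q - y) \<le> norm (A q) / r"
proof -
  interpret A: bounded_linear A by (rule lin)
  note range = symmetric_gap_on_range[OF lin sym \<open>r > 0\<close> below]
  \<comment> \<open>With \<open>z k \<le> r\<close>, absorbing \<open>z k * norm (A (w k))\<close>
    costs half of the factor \<open>2 * r\<close> and leaves the \<open>r\<close> of the
    conclusion.\<close>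
  define z where "z k = r / real (Suc k)" for k
  have z: "0 < z k" "z k \<le> r" for k
    using \<open>r > 0\<close> by (auto simp: z_def field_simps)
  have z_lim: "z \<longlonglongrightarrow> 0"
    unfolding z_def by (rule lim_const_over_n[THEN LIMSEQ_Suc])
  have "\<exists>w. A w - z k *\<^sub>R w = q" for k
    using surjD[OF onto[of "z k"], of q] z[of k] \<open>r > 0\<close> by auto
  then have "\<exists>w. \<forall>k. A (w k) - z k *\<^sub>R w k = q" by (intro choice allI)
  then obtain w where w: "\<And>k. A (w k) - z k *\<^sub>R w k = q" by blast
  have AA: "A (A (w k)) = A q + z k *\<^sub>R A (w k)" for k
    by (simp add: w[of k, symmetric] A.diff A.scaleR)
  have bound: "norm (A (w k)) \<le> norm (A q) / r" for k
  proof -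
    have "2 * r * norm (A (w k)) \<le> norm (A q + z k *\<^sub>R A (w k))"
      using range[of "w k"] by (simp add: AA)
    also have "\<dots> \<le> norm (A q) + z k * norm (A (w k))"
      using norm_triangle_ineq[of "A q" "z k *\<^sub>R A (w k)"] z[of k] by simp
    also have "\<dots> \<le> norm (A q) + r * norm (A (w k))"
      using z[of k] by (simp add: mult_right_mono)
    finally show ?thesis using \<open>r > 0\<close> by (simp add: field_simps)
  qed
  have to_0: "(\<lambda>k. z k *\<^sub>R A (w k)) \<longlonglongrightarrow> 0"
  proof (rule Lim_null_comparison)
    have "norm (z k *\<^sub>R A (w k)) \<le> z k * (norm (A q) / r)" for k
      using mult_left_mono[OF bound[of k], of "z k"] z[of k] by simp
    then show "\<forall>\<^sub>F k in sequentially. norm (z k *\<^sub>R A (w k)) \<le> z k * (norm (A q) / r)"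
      by simp
    show "(\<lambda>k. z k * (norm (A q) / r)) \<longlonglongrightarrow> 0"
      using tendsto_mult_right[OF z_lim, of "norm (A q) / r"] by simp
  qed
  \<comment> \<open>The \<open>w k\<close> themselves may diverge. The estimate \<open>range\<close>
    at \<open>w m - w n\<close> transfers the Cauchy property from \<open>A (A (w k))\<close>, whose
    constant part \<open>A q\<close> cancels.\<close>
  have "Cauchy (\<lambda>k. A (w k))"
  proof (rule metric_CauchyI)
    fix e :: real assume "e > 0"
    have "Cauchy (\<lambda>k. z k *\<^sub>R A (w k))"
      using to_0 by (rule LIMSEQ_imp_Cauchy)
    from metric_CauchyD[OF this, of "2 * r * e"] \<open>r > 0\<close> \<open>e > 0\<close>
    obtain N where N: "\<And>m n. m \<ge> N \<Longrightarrow> n \<ge> N \<Longrightarrow>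
        dist (z m *\<^sub>R A (w m)) (z n *\<^sub>R A (w n)) < 2 * r * e"
      by auto
    have "dist (A (w m)) (A (w n)) < e" if "m \<ge> N" "n \<ge> N" for m n
    proof -
      have "2 * r * norm (A (w m - w n)) \<le> norm (A (A (w m - w n)))"
        by (rule range)
      also have "\<dots> < 2 * r * e"
        using N[OF that] by (simp add: A.diff AA dist_norm)
      finally show ?thesis using \<open>r > 0\<close> by (simp add: A.diff dist_norm)
    qed
    then show "\<exists>M. \<forall>m\<ge>M. \<forall>n\<ge>M. dist (A (w m)) (A (w n)) < e" by blast
  qed
  then obtain l where l: "(\<lambda>k. A (w k)) \<longlonglongrightarrow> l"
    using Cauchy_convergent convergent_def by blast
  have "(\<lambda>k. A (A (w k))) \<longlonglongrightarrow> A q"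
    unfolding AA using tendsto_add[OF tendsto_const to_0] by simp
  then have "A l = A q"
    using A.tendsto[OF l] LIMSEQ_unique by blast
  moreover have "norm l \<le> norm (A q) / r"
    using tendsto_norm[OF l] bound by (intro LIMSEQ_le_const2) auto
  ultimately show thesis
    by (intro that[of "q - l"]) (auto simp: A.diff)
qed

section \<open>The Hilbert space of square-summable functions\<close>

text \<open>A type of its own makes the library theory of \<open>real_inner\<close> and
  \<open>complete_space\<close> applicable to square-summable functions.\<close>

typedef 'a l2 = "ell2 :: ('a \<Rightarrow> complex) set" morphisms l2_apply l2_abs
  by (rule exI[of _ "\<lambda>_. 0"]) (simp add: ell2_def)

setup_lifting type_definition_l2

lemma l2_eqI: "(\<And>n. l2_apply x n = l2_apply y n) \<Longrightarrow> x = y"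
  by (metis l2_apply_inject ext)

lemma ell2_add:
  assumes "u \<in> ell2" "v \<in> ell2"
  shows "(\<lambda>n. u n + v n) \<in> ell2"
proof -
  have "(\<lambda>n. 2 * (cmod (u n))\<^sup>2 + 2 * (cmod (v n))\<^sup>2) summable_on UNIV"
    using assms by (intro summable_on_add summable_on_cmult_right) (auto simp: ell2_def)
  then have "(\<lambda>n. (cmod (u n + v n))\<^sup>2) summable_on UNIV"
  proof (rule summable_on_comparison_test)
    fix n
    have "(cmod (u n + v n))\<^sup>2 \<le> (cmod (u n) + cmod (v n))\<^sup>2"
      by (intro power_mono norm_triangle_ineq) auto
    also have "\<dots> \<le> 2 * (cmod (u n))\<^sup>2 + 2 * (cmod (v n))\<^sup>2"
      using sum_squares_bound[of "cmod (u n)" "cmod (v n)"] by (simp add: power2_sum)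
    finally show "(cmod (u n + v n))\<^sup>2 \<le> 2 * (cmod (u n))\<^sup>2 + 2 * (cmod (v n))\<^sup>2" .
  qed auto
  then show ?thesis by (simp add: ell2_def)
qed

lemma ell2_mult_bounded:
  assumes "u \<in> ell2" "\<And>n. cmod (a n) \<le> C"
  shows "(\<lambda>n. a n * u n) \<in> ell2"
proof -
  have "(\<lambda>n. C\<^sup>2 * (cmod (u n))\<^sup>2) summable_on UNIV"
    using assms by (intro summable_on_cmult_right) (auto simp: ell2_def)
  then have "(\<lambda>n. (cmod (a n * u n))\<^sup>2) summable_on UNIV"
    by (rule summable_on_comparison_test)
      (auto simp: norm_mult power_mult_distrib intro!: mult_right_mono power_mono assms)
  then show ?thesis by (simp add: ell2_def)
qed

lemma ell2_scale: "u \<in> ell2 \<Longrightarrow> (\<lambda>n. a * u n) \<in> ell2"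
  by (rule ell2_mult_bounded[of u "\<lambda>_. a" "cmod a"]) auto

lemma ell2_inner_summable:
  assumes "u \<in> ell2" "v \<in> ell2"
  shows "(\<lambda>n. inner (u n) (v n)) summable_on UNIV"
proof -
  have "(\<lambda>n. (cmod (u n))\<^sup>2 + (cmod (v n))\<^sup>2) summable_on UNIV"
    using assms by (intro summable_on_add) (auto simp: ell2_def)
  then have "(\<lambda>n. norm (inner (u n) (v n))) summable_on UNIV"
  proof (rule Infinite_Sum.abs_summable_on_comparison_test')
    fix n
    have "\<bar>inner (u n) (v n)\<bar> \<le> cmod (u n) * cmod (v n)"
      by (rule Cauchy_Schwarz_ineq2)
    moreover have "0 \<le> cmod (u n) * cmod (v n)" by simp
    ultimately show "norm (inner (u n) (v n)) \<le> (cmod (u n))\<^sup>2 + (cmod (v n))\<^sup>2"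
      using sum_squares_bound[of "cmod (u n)" "cmod (v n)"] by simp
  qed
  then show ?thesis by (rule abs_summable_summable)
qed

text \<open>The class provides real scalars only; complex multiples are supplied separately by
  \<open>cscale_l2\<close>.\<close>

instantiation l2 :: (type) real_vector
begin

lift_definition zero_l2 :: "'a l2" is "\<lambda>_. 0"
  by (simp add: ell2_def)

lift_definition plus_l2 :: "'a l2 \<Rightarrow> 'a l2 \<Rightarrow> 'a l2" is "\<lambda>u v n. u n + v n"
  by (rule ell2_add)

lift_definition uminus_l2 :: "'a l2 \<Rightarrow> 'a l2" is "\<lambda>u n. - u n"
  by (simp add: ell2_def)

lift_definition minus_l2 :: "'a l2 \<Rightarrow> 'a l2 \<Rightarrow> 'a l2" is "\<lambda>u v n. u n - v n"
  subgoal for u v using ell2_add[of u "\<lambda>n. - v n"] by (simp add: ell2_def)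
  done

lift_definition scaleR_l2 :: "real \<Rightarrow> 'a l2 \<Rightarrow> 'a l2" is "\<lambda>r u n. r *\<^sub>R u n"
  by (simp add: scaleR_conv_of_real ell2_scale)

instance
  by (standard; transfer) (simp_all add: fun_eq_iff algebra_simps)

end

text \<open>The inner product is the real part of the complex one, so that the library class
  \<open>real_inner\<close> applies; complex-linear symmetric operators are symmetric for it as well.\<close>

instantiation l2 :: (type) real_inner
begin

lift_definition inner_l2 :: "'a l2 \<Rightarrow> 'a l2 \<Rightarrow> real"
  is "\<lambda>u v. \<Sum>\<^sub>\<infinity>n. inner (u n) (v n)" .

definition norm_l2 :: "'a l2 \<Rightarrow> real" where
  "norm_l2 x = sqrt (inner x x)"

definition sgn_l2 :: "'a l2 \<Rightarrow> 'a l2" where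
  "sgn_l2 x = x /\<^sub>R norm x"

definition dist_l2 :: "'a l2 \<Rightarrow> 'a l2 \<Rightarrow> real" where
  "dist_l2 x y = norm (x - y)"

definition uniformity_l2 :: "('a l2 \<times> 'a l2) filter" where
  "uniformity_l2 = (INF e\<in>{0<..}. principal {(x, y). dist x y < e})"

definition open_l2 :: "'a l2 set \<Rightarrow> bool" where
  "open_l2 S = (\<forall>x\<in>S. \<forall>\<^sub>F (x', y) in uniformity. x' = x \<longrightarrow> y \<in> S)"

instance
proof
  fix x y z :: "'a l2" and r :: real
  show "dist x y = norm (x - y)" by (rule dist_l2_def)
  show "sgn x = x /\<^sub>R norm x" by (rule sgn_l2_def)
  show "uniformity = (INF e\<in>{0<..}. principal {(x::'a l2, y). dist x y < e})"
    by (rule uniformity_l2_def)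
  show "open S = (\<forall>x\<in>S. \<forall>\<^sub>F (x', y) in uniformity. x' = x \<longrightarrow> y \<in> S)" for S :: "'a l2 set"
    by (rule open_l2_def)
  show "norm x = sqrt (inner x x)" by (rule norm_l2_def)
  show "inner x y = inner y x"
    by transfer (simp add: inner_commute)
  show "inner (x + y) z = inner x z + inner y z"
    by transfer (simp add: inner_add_left infsum_add ell2_inner_summable)
  show "inner (r *\<^sub>R x) y = r * inner x y"
    by transfer (simp add: infsum_cmult_right')
  show "0 \<le> inner x x"
    by transfer (simp add: infsum_nonneg)
  show "inner x x = 0 \<longleftrightarrow> x = 0"
  proof transfer
    fix u :: "'a \<Rightarrow> complex" assume u: "u \<in> ell2"
    have "u n = 0" if "(\<Sum>\<^sub>\<infinity>n. inner (u n) (u n)) = 0" for n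
    proof -
      have "inner (u n) (u n) \<le> 0"
        using finite_sum_le_infsum[OF ell2_inner_summable[OF u u], of "{n}"] that by simp
      then show ?thesis by (simp add: dot_square_norm)
    qed
    then show "(\<Sum>\<^sub>\<infinity>n. inner (u n) (u n)) = 0 \<longleftrightarrow> u = (\<lambda>_. 0)"
      by (metis (mono_tags, lifting) ext infsum_0 inner_zero_left)
  qed
qed

end

section \<open>Finite sums, the norm and completeness\<close>

lemma norm_l2_eq_ell2_norm: "norm x = ell2_norm (l2_apply x)"
  by (simp add: norm_l2_def inner_l2.rep_eq ell2_norm_def power2_norm_eq_inner)

lemma norm_l2_power2: "(norm x)\<^sup>2 = (\<Sum>\<^sub>\<infinity>n. (cmod (l2_apply x n))\<^sup>2)"
  by (simp add: power2_norm_eq_inner inner_l2.rep_eq)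

lemma l2_apply_summable: "(\<lambda>n. (cmod (l2_apply x n))\<^sup>2) summable_on UNIV"
  using l2_apply[of x] by (simp add: ell2_def)

lemma sum_le_norm_l2: "finite F \<Longrightarrow> (\<Sum>n\<in>F. (cmod (l2_apply x n))\<^sup>2) \<le> (norm x)\<^sup>2"
  unfolding norm_l2_power2 by (intro finite_sum_le_infsum l2_apply_summable) auto

lemma norm_l2_apply_le: "cmod (l2_apply x n) \<le> norm x"
  using sum_le_norm_l2[of "{n}" x] by (simp add: power2_le_iff_abs_le)

lemma ell2_bounded_sums:
  assumes "\<And>F. finite F \<Longrightarrow> (\<Sum>n\<in>F. (cmod (u n))\<^sup>2) \<le> C"
  shows "u \<in> ell2"
  unfolding ell2_def
  by (auto intro!: nonneg_bounded_partial_sums_imp_summable_on[of _ _ C] assms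
      eventually_finite_subsets_at_top_weakI)

lemma norm_l2_le_bounded_sums:
  assumes "0 \<le> C" "\<And>F. finite F \<Longrightarrow> (\<Sum>n\<in>F. (cmod (l2_apply x n))\<^sup>2) \<le> C\<^sup>2"
  shows "norm x \<le> C"
proof -
  have "(norm x)\<^sup>2 \<le> C\<^sup>2"
    unfolding norm_l2_power2 by (intro infsum_le_finite_sums l2_apply_summable assms)
  then show ?thesis using \<open>0 \<le> C\<close> by (rule power2_le_imp_le)
qed

text \<open>The limit is taken pointwise. Letting \<open>j\<close> tend to infinity in sums over a
  finite set gives bounds independent of that set, which therefore pass to the norm.\<close>

instance l2 :: (type) complete_space
proof
  fix X :: "nat \<Rightarrow> 'a l2" assume X: "Cauchy X"
  have "Cauchy (\<lambda>k. l2_apply (X k) n)" for n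
  proof (rule metric_CauchyI)
    fix e :: real assume "e > 0"
    from metric_CauchyD[OF X this] obtain N
      where N: "\<And>i j. i \<ge> N \<Longrightarrow> j \<ge> N \<Longrightarrow> dist (X i) (X j) < e" by blast
    have "dist (l2_apply (X i) n) (l2_apply (X j) n) \<le> dist (X i) (X j)" for i j
      using norm_l2_apply_le[of "X i - X j" n] by (simp add: dist_norm minus_l2.rep_eq)
    with N show "\<exists>M. \<forall>i\<ge>M. \<forall>j\<ge>M. dist (l2_apply (X i) n) (l2_apply (X j) n) < e"
      by (meson le_less_trans)
  qed
  then have "\<forall>n. \<exists>a. (\<lambda>k. l2_apply (X k) n) \<longlonglongrightarrow> a"
    by (simp add: Cauchy_convergent convergent_def[symmetric])
  then obtain u where u: "\<And>n. (\<lambda>k. l2_apply (X k) n) \<longlonglongrightarrow> u n"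
    by metis
  have near: "(\<Sum>n\<in>F. (cmod (l2_apply (X i) n - u n))\<^sup>2) \<le> e\<^sup>2"
    if "finite F" "\<And>j. j \<ge> N \<Longrightarrow> dist (X i) (X j) < e" for F N i e
  proof (rule LIMSEQ_le_const2)
    show "(\<lambda>j. \<Sum>n\<in>F. (cmod (l2_apply (X i) n - l2_apply (X j) n))\<^sup>2)
        \<longlonglongrightarrow> (\<Sum>n\<in>F. (cmod (l2_apply (X i) n - u n))\<^sup>2)"
      by (intro tendsto_intros u)
    have "(\<Sum>n\<in>F. (cmod (l2_apply (X i) n - l2_apply (X j) n))\<^sup>2) \<le> e\<^sup>2" if "j \<ge> N" for j
    proof -
      have "(\<Sum>n\<in>F. (cmod (l2_apply (X i) n - l2_apply (X j) n))\<^sup>2) \<le> (norm (X i - X j))\<^sup>2"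
        using sum_le_norm_l2[OF \<open>finite F\<close>, of "X i - X j"] by (simp add: minus_l2.rep_eq)
      also have "\<dots> \<le> e\<^sup>2"
        using \<open>\<And>j. j \<ge> N \<Longrightarrow> dist (X i) (X j) < e\<close>[OF that]
        by (intro power_mono) (auto simp: dist_norm)
      finally show ?thesis .
    qed
    then show "\<exists>M. \<forall>j\<ge>M. (\<Sum>n\<in>F. (cmod (l2_apply (X i) n - l2_apply (X j) n))\<^sup>2) \<le> e\<^sup>2"
      by blast
  qed
  \<comment> \<open>Radius 1 serves only to place \<open>u\<close> in \<open>ell2\<close>, as
    \<open>X N\<close> minus a square-summable function.\<close>
  obtain N where N: "\<And>i j. i \<ge> N \<Longrightarrow> j \<ge> N \<Longrightarrow> dist (X i) (X j) < 1"
    using metric_CauchyD[OF X, of 1] by auto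
  have "(\<lambda>n. l2_apply (X N) n - u n) \<in> ell2"
    using near[OF _ N[of N]] by (intro ell2_bounded_sums) auto
  then have "(\<lambda>n. - 1 * (l2_apply (X N) n - u n)) \<in> ell2"
    by (rule ell2_scale)
  from ell2_add[OF l2_apply[of "X N"] this] have "u \<in> ell2" by simp
  then have l: "l2_apply (l2_abs u) = u" by (rule l2_abs_inverse)
  have "X \<longlonglongrightarrow> l2_abs u"
  proof (rule metric_LIMSEQ_I)
    fix e :: real assume "e > 0"
    from metric_CauchyD[OF X, of "e / 2"] \<open>e > 0\<close> obtain N
      where N: "\<And>i j. i \<ge> N \<Longrightarrow> j \<ge> N \<Longrightarrow> dist (X i) (X j) < e / 2" by auto
    have "norm (X i - l2_abs u) \<le> e / 2" if "i \<ge> N" for i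
      using near[OF _ N[OF that]] \<open>e > 0\<close>
      by (intro norm_l2_le_bounded_sums) (auto simp: minus_l2.rep_eq l)
    then show "\<exists>N. \<forall>i\<ge>N. dist (X i) (l2_abs u) < e"
      using \<open>e > 0\<close> by (intro exI[of _ N]) (force simp: dist_norm)
  qed
  then show "convergent X" by (rule convergentI)
qed

section \<open>Complex multiples, restrictions and translations\<close>

lift_definition cscale_l2 :: "complex \<Rightarrow> 'a l2 \<Rightarrow> 'a l2" is "\<lambda>a u n. a * u n"
  by (rule ell2_scale)

lift_definition restrict_l2 :: "'a set \<Rightarrow> 'a l2 \<Rightarrow> 'a l2" is "\<lambda>S u n. indicator S n * u n"
  by (rule ell2_mult_bounded[where C = 1]) (auto simp: indicator_def)

text \<open>With this sign the support moves by \<open>- e\<close>: a point \<open>n\<close> is in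
  the new support iff \<open>n + e\<close> is in the old one.\<close>

lift_definition shift_l2 :: "'a::ab_group_add \<Rightarrow> 'a l2 \<Rightarrow> 'a l2" is "\<lambda>e u n. u (n + e)"
proof -
  fix e :: 'a and u :: "'a \<Rightarrow> complex" assume "u \<in> ell2"
  then show "(\<lambda>n. u (n + e)) \<in> ell2"
    using summable_on_reindex_bij_betw[of "\<lambda>n. n + e" UNIV UNIV "\<lambda>n. (cmod (u n))\<^sup>2"]
    by (simp add: ell2_def bij_plus_right)
qed

lemma l2_apply_sum: "l2_apply (\<Sum>i\<in>I. f i) n = (\<Sum>i\<in>I. l2_apply (f i) n)"
  by (induction I rule: infinite_finite_induct) (auto simp: zero_l2.rep_eq plus_l2.rep_eq)

lemmas l2_reps = zero_l2.rep_eq plus_l2.rep_eq minus_l2.rep_eq uminus_l2.rep_eq scaleR_l2.rep_eq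
  cscale_l2.rep_eq restrict_l2.rep_eq shift_l2.rep_eq l2_apply_sum

lemma norm_cscale_l2: "norm (cscale_l2 a x) = cmod a * norm x"
proof -
  have "(norm (cscale_l2 a x))\<^sup>2 = (cmod a * norm x)\<^sup>2"
    unfolding power_mult_distrib norm_l2_power2
    by (simp add: cscale_l2.rep_eq norm_mult power_mult_distrib infsum_cmult_right')
  then show ?thesis by simp
qed

text \<open>Since the inner product is real, imaginary parts become visible only by taking a
  multiple of \<open>\<i>\<close> as one factor.\<close>

lemma inner_cscale_l2: "inner (cscale_l2 a x) (cscale_l2 b x) = Re (a * cnj b) * (norm x)\<^sup>2"
proof -
  have "inner (a * u) (b * u) = Re (a * cnj b) * (cmod u)\<^sup>2" for u
    unfolding inner_complex_def cmod_power2 by simp algebra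
  then show ?thesis
    by (simp add: norm_l2_power2 inner_l2.rep_eq cscale_l2.rep_eq infsum_cmult_right')
qed

lemma inner_restrict_l2: "inner (restrict_l2 S x) y = inner x (restrict_l2 S y)"
  unfolding inner_l2.rep_eq by (intro infsum_cong) (simp add: restrict_l2.rep_eq indicator_def)

lemma restrict_l2_idem: "restrict_l2 S (restrict_l2 S x) = restrict_l2 S x"
  by (rule l2_eqI) (simp add: l2_reps indicator_def)

text \<open>Pythagoras: restriction is symmetric and idempotent, hence an orthogonal
  projection.\<close>

lemma norm_restrict_l2_diff: "(norm (x - restrict_l2 S x))\<^sup>2 = (norm x)\<^sup>2 - (norm (restrict_l2 S x))\<^sup>2"
  using inner_restrict_l2[of S "restrict_l2 S x" x]
  by (simp add: power2_norm_eq_inner inner_diff_left inner_diff_right restrict_l2_idem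
      inner_commute[of x "restrict_l2 S x"])

lemma norm_restrict_l2_le: "norm (restrict_l2 S x) \<le> norm x"
proof (rule power2_le_imp_le)
  show "(norm (restrict_l2 S x))\<^sup>2 \<le> (norm x)\<^sup>2"
    using norm_restrict_l2_diff[of x S] zero_le_power2[of "norm (x - restrict_l2 S x)"] by linarith
qed simp

lemma bounded_linear_restrict_l2: "bounded_linear (restrict_l2 S)"
proof (rule bounded_linear_intro[where K = 1])
  show "restrict_l2 S (x + y) = restrict_l2 S x + restrict_l2 S y" for x y
    by (rule l2_eqI) (simp add: l2_reps distrib_left)
  show "restrict_l2 S (r *\<^sub>R x) = r *\<^sub>R restrict_l2 S x" for r x
    by (rule l2_eqI) (simp add: l2_reps)
  show "norm (restrict_l2 S x) \<le> norm x * 1" for x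
    by (simp add: norm_restrict_l2_le)
qed

lemma inner_shift_l2: "inner (shift_l2 e x) y = inner x (shift_l2 (- e) y)"
  unfolding inner_l2.rep_eq shift_l2.rep_eq
  using infsum_reindex_bij_betw[of "\<lambda>n. n + e" UNIV UNIV
      "\<lambda>n. inner (l2_apply x n) (l2_apply y (n + - e))"]
  by (simp add: bij_plus_right)

lemma norm_shift_l2: "norm (shift_l2 e x) = norm x"
proof -
  have "shift_l2 (- e) (shift_l2 e x) = x"
    by (rule l2_eqI) (simp add: l2_reps)
  then show ?thesis by (simp add: norm_eq_sqrt_inner inner_shift_l2)
qed

lemma bounded_linear_shift_l2: "bounded_linear (shift_l2 e)"
  by (rule bounded_linear_intro[where K = 1])
    (auto intro!: l2_eqI simp: l2_reps norm_shift_l2)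

text \<open>Finite sums approach the squared norm, and by Pythagoras the missing part is the squared
  norm of the tail.\<close>

lemma l2_truncation:
  assumes "\<epsilon> > 0"
  obtains F where "finite F" "norm (x - restrict_l2 F x) < \<epsilon>"
proof -
  have "eventually (\<lambda>F. (norm x)\<^sup>2 - \<epsilon>\<^sup>2 < (\<Sum>n\<in>F. (cmod (l2_apply x n))\<^sup>2)) (finite_subsets_at_top UNIV)"
    using infsum_tendsto[OF l2_apply_summable[of x]] assms
    by (intro order_tendstoD(1)) (auto simp: norm_l2_power2)
  then obtain F where F: "finite F" "(norm x)\<^sup>2 - \<epsilon>\<^sup>2 < (\<Sum>n\<in>F. (cmod (l2_apply x n))\<^sup>2)"
    by (auto simp: eventually_finite_subsets_at_top)
  have "(\<Sum>n\<in>F. (cmod (l2_apply x n))\<^sup>2) = (\<Sum>n\<in>F. (cmod (l2_apply (restrict_l2 F x) n))\<^sup>2)"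
    by (intro sum.cong) (auto simp: restrict_l2.rep_eq)
  also have "\<dots> \<le> (norm (restrict_l2 F x))\<^sup>2"
    using F(1) by (rule sum_le_norm_l2)
  finally have "(norm (x - restrict_l2 F x))\<^sup>2 < \<epsilon>\<^sup>2"
    using F(2) by (simp add: norm_restrict_l2_diff)
  then show thesis
    using F(1) assms by (intro that[of F]) (auto intro: power2_less_imp_less)
qed

section \<open>The operator on the Hilbert space\<close>

text \<open>Composing translations and a restriction lets boundedness and symmetry follow term by
  term.\<close>

definition H0_l2 :: "(int ^ 'd::finite) set \<Rightarrow> real \<Rightarrow> (int ^ 'd) l2 \<Rightarrow> (int ^ 'd) l2" where
  "H0_l2 D M x = (\<Sum>e | l1_norm e = 1. shift_l2 e x - x) + (4 * real CARD('d)) *\<^sub>R x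
     + M *\<^sub>R restrict_l2 (- D) x"

lemma l2_apply_H0_l2:
  fixes x :: "(int ^ 'd::finite) l2"
  shows "l2_apply (H0_l2 D M x) = H0_tilde D M (l2_apply x)"
proof
  fix n :: "int ^ 'd"
  have "(\<Sum>m | l1_norm (m - n) = 1. l2_apply x m - l2_apply x n)
      = (\<Sum>e | l1_norm e = 1. l2_apply x (n + e) - l2_apply x n)"
    by (rule sum.reindex_bij_witness[of _ "\<lambda>e. n + e" "\<lambda>m. m - n"]) auto
  then show "l2_apply (H0_l2 D M x) n = H0_tilde D M (l2_apply x) n"
    by (simp add: H0_l2_def H0_tilde_def laplacian_def l2_reps scaleR_conv_of_real)
qed

lemma bounded_linear_H0_l2: "bounded_linear (H0_l2 D M)"
  unfolding H0_l2_def
  by (intro bounded_linear_add bounded_linear_sum bounded_linear_sub bounded_linear_shift_l2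
      bounded_linear_ident bounded_linear_const_scaleR bounded_linear_restrict_l2)

lemma H0_l2_symmetric: "inner (H0_l2 D M x) y = inner x (H0_l2 D M y)"
proof -
  \<comment> \<open>The adjoint of \<open>shift_l2 e\<close> is \<open>shift_l2 (- e)\<close>, and
    the unit sphere is invariant under negation.\<close>
  have "(\<Sum>e | l1_norm e = 1. inner x (shift_l2 (- e) y - y))
      = (\<Sum>e | l1_norm e = 1. inner x (shift_l2 e y - y))"
    by (rule sum.reindex_bij_witness[of _ uminus uminus]) (auto simp: l1_norm_def)
  then show ?thesis
    by (simp add: H0_l2_def inner_add_left inner_add_right inner_sum_left inner_sum_right
        inner_diff_left inner_diff_right inner_shift_l2 inner_restrict_l2)
qed

lemma H0_l2_cscale: "H0_l2 D M (cscale_l2 a x) = cscale_l2 a (H0_l2 D M x)"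
  by (rule l2_eqI)
    (simp add: H0_l2_def l2_reps distrib_left right_diff_distrib sum_distrib_left
      scaleR_conv_of_real mult.left_commute)

text \<open>Only the potential fails to commute with translations, and it acts pointwise. So
  \<open>D\<close> and its translate have to agree just on the support, not on its
  neighbours.\<close>

lemma H0_l2_shift:
  assumes "\<And>n. l2_apply x (n + y) \<noteq> 0 \<Longrightarrow> n \<in> D \<longleftrightarrow> n + y \<in> D"
  shows "H0_l2 D M (shift_l2 y x) = shift_l2 y (H0_l2 D M x)"
proof (rule l2_eqI)
  fix n
  have "indicator (- D) n * l2_apply x (n + y) = indicator (- D) (n + y) * l2_apply x (n + y)"
    using assms[of n] by (auto simp: indicator_def)
  then show "l2_apply (H0_l2 D M (shift_l2 y x)) n = l2_apply (shift_l2 y (H0_l2 D M x)) n"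
    by (simp add: H0_l2_def l2_reps add_ac)
qed

text \<open>Symmetry tested on \<open>x\<close> and \<open>\<i>\<close> times \<open>x\<close>
  equates \<open>Im z\<close> and \<open>- Im z\<close>, up to the factor
  \<open>(norm x)\<^sup>2\<close>.\<close>

lemma H0_l2_eigenvalue_real:
  assumes "H0_l2 D M x = cscale_l2 z x" "x \<noteq> 0"
  shows "z = complex_of_real (Re z)"
proof -
  have "inner (cscale_l2 z x) (cscale_l2 \<i> x) = inner x (H0_l2 D M (cscale_l2 \<i> x))"
    by (simp only: assms(1)[symmetric] H0_l2_symmetric)
  also have "H0_l2 D M (cscale_l2 \<i> x) = cscale_l2 (\<i> * z) x"
    unfolding H0_l2_cscale assms(1) by (rule l2_eqI) (simp add: l2_reps)
  also have "inner x (cscale_l2 (\<i> * z) x) = inner (cscale_l2 1 x) (cscale_l2 (\<i> * z) x)"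
    by (rule arg_cong2[of _ _ _ _ inner]) (auto intro!: l2_eqI simp: l2_reps)
  finally have "Im z = 0"
    using assms(2) by (simp add: inner_cscale_l2)
  then show ?thesis by (simp add: complex_eq_iff)
qed

text \<open>Supplies the two hypotheses of the gap lemmas: the norm bound of the inverse gives the
  lower bound, and its being a right inverse gives surjectivity.\<close>

lemma resolvent_set_l2:
  fixes A :: "'a l2 \<Rightarrow> 'a l2"
  assumes "complex_of_real t \<in> resolvent_set T"
    and rep: "\<And>x. l2_apply (A x) = T (l2_apply x)"
  shows "\<exists>\<kappa>>0. \<forall>x. \<kappa> * norm x \<le> norm (A x - t *\<^sub>R x)" and "surj (\<lambda>x. A x - t *\<^sub>R x)"
proof -
  obtain S where S: "bounded_op S"
    and inv: "\<And>u. u \<in> ell2 \<Longrightarrow> S (shifted_op T t u) = u" "\<And>u. u \<in> ell2 \<Longrightarrow> shifted_op T t (S u) = u"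
    using assms(1) by (auto simp: resolvent_set_def)
  have mem: "S u \<in> ell2" if "u \<in> ell2" for u
    using S that by (simp add: bounded_op_def)
  obtain C where C: "\<And>u. u \<in> ell2 \<Longrightarrow> ell2_norm (S u) \<le> C * ell2_norm u"
    using S unfolding bounded_op_def by blast
  have shifted: "l2_apply (A x - t *\<^sub>R x) = shifted_op T t (l2_apply x)" for x
    by (simp add: fun_eq_iff l2_reps rep shifted_op_def scaleR_conv_of_real)
  \<comment> \<open>The constant \<open>C\<close> need not be positive; the maximum makes its
    reciprocal usable as \<open>\<kappa>\<close>.\<close>
  have "norm x \<le> max C 1 * norm (A x - t *\<^sub>R x)" for x
  proof -
    have "norm x \<le> C * norm (A x - t *\<^sub>R x)"
      using C[OF l2_apply[of "A x - t *\<^sub>R x"]]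
      by (simp only: norm_l2_eq_ell2_norm shifted inv(1)[OF l2_apply])
    also have "\<dots> \<le> max C 1 * norm (A x - t *\<^sub>R x)"
      by (intro mult_right_mono) auto
    finally show ?thesis .
  qed
  then show "\<exists>\<kappa>>0. \<forall>x. \<kappa> * norm x \<le> norm (A x - t *\<^sub>R x)"
    by (intro exI[of _ "1 / max C 1"]) (auto simp: field_simps)
  have "A (l2_abs (S (l2_apply y))) - t *\<^sub>R l2_abs (S (l2_apply y)) = y" for y
    by (rule l2_eqI) (simp only: shifted l2_abs_inverse[OF mem[OF l2_apply]] inv(2)[OF l2_apply])
  then show "surj (\<lambda>x. A x - t *\<^sub>R x)" by (rule surjI)
qed

section \<open>Recurrence of patterns\<close>

text \<open>Greedy choice: if the translates of \<open>K\<close> by \<open>y\<close> and by an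
  earlier \<open>y'\<close> meet, then \<open>y - y'\<close> is a difference of two points of
  \<open>K\<close>, so each earlier choice excludes only finitely many \<open>y\<close>.\<close>

lemma infinite_disjoint_translates:
  fixes K Y :: "'a::ab_group_add set"
  assumes "infinite Y" "finite K"
  obtains F where "F \<subseteq> Y" "finite F" "card F = N"
    "\<And>y y' n. y \<in> F \<Longrightarrow> y' \<in> F \<Longrightarrow> n + y \<in> K \<Longrightarrow> n + y' \<in> K \<Longrightarrow> y = y'"
proof -
  have "\<exists>F \<subseteq> Y. finite F \<and> card F = N \<and>
      (\<forall>y\<in>F. \<forall>y'\<in>F. \<forall>n. n + y \<in> K \<longrightarrow> n + y' \<in> K \<longrightarrow> y = y')"
  proof (induction N)
    case 0
    then show ?case by (intro exI[of _ "{}"]) auto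
  next
    case (Suc N)
    then obtain F where F: "F \<subseteq> Y" "finite F" "card F = N"
      and disj: "\<And>y y' n. y \<in> F \<Longrightarrow> y' \<in> F \<Longrightarrow> n + y \<in> K \<Longrightarrow> n + y' \<in> K \<Longrightarrow> y = y'"
      by blast
    let ?bad = "(\<lambda>(y, k, k'). y + k' - k) ` (F \<times> K \<times> K)"
    have "finite (F \<union> ?bad)" using F \<open>finite K\<close> by blast
    then have "Y - (F \<union> ?bad) \<noteq> {}"
      using \<open>infinite Y\<close> Diff_infinite_finite by (intro infinite_imp_nonempty) blast
    then obtain y where y: "y \<in> Y" "y \<notin> F" "y \<notin> ?bad" by blast
    have new: False if "y' \<in> F" "n + y \<in> K" "n + y' \<in> K" for y' n
    proof -
      have "y = y' + (n + y) - (n + y')" by simp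
      with that have "y \<in> ?bad" by (intro image_eqI[of _ _ "(y', n + y', n + y)"]) auto
      with y show False by simp
    qed
    show ?case
    proof (intro exI conjI)
      show "insert y F \<subseteq> Y" "finite (insert y F)" "card (insert y F) = Suc N"
        using F y by auto
      show "\<forall>z\<in>insert y F. \<forall>y'\<in>insert y F. \<forall>n. n + z \<in> K \<longrightarrow> n + y' \<in> K \<longrightarrow> z = y'"
        using disj new by blast
    qed
  qed
  then show thesis using that by blast
qed

text \<open>Counting points on a diagonal suffices, because only unboundedness in \<open>L\<close>
  is wanted. Rounding the centre down costs less than 1, hence the bound
  \<open>real k + 1\<close>.\<close>

lemma card_lattice_cube_ge:
  fixes c :: "real ^ 'd::finite"
  assumes "finite (lattice_cube c (real L))"
  shows "L div 2 \<le> card (lattice_cube c (real L))"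
proof -
  let ?p = "\<lambda>k::nat. \<chi> i. \<lfloor>c $ i\<rfloor> + int k"
  have "?p ` {..<L div 2} \<subseteq> lattice_cube c (real L)"
  proof clarify
    fix k assume "k < L div 2"
    then have "real k + 1 \<le> real L / 2" by linarith
    moreover have "\<bar>of_int (\<lfloor>c $ i\<rfloor> + int k) - c $ i\<bar> \<le> real k + 1" for i
      using floor_correct[of "c $ i"] unfolding abs_le_iff of_int_add of_int_of_nat_eq by linarith
    ultimately have "\<bar>of_int (\<lfloor>c $ i\<rfloor> + int k) - c $ i\<bar> \<le> real L / 2" for i
      by (rule order_trans[rotated])
    then show "?p k \<in> lattice_cube c (real L)"
      by (simp only: lattice_cube_def mem_Collect_eq vec_lambda_beta simp_thms)
  qed
  moreover have "inj_on ?p {..<L div 2}"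
    by (auto simp: inj_on_def vec_eq_iff)
  ultimately show ?thesis
    using card_inj_on_le[OF _ _ assms, of ?p "{..<L div 2}"] by simp
qed

text \<open>Each occurrence is determined by its translation. Finitely many translations would bound
  the number of occurrences while the cubes grow, so the frequency would tend to 0.\<close>

lemma infinite_pattern_translations:
  fixes D :: "(int ^ 'd::finite) set"
  assumes freq: "strict_uniform_pattern_frequency c D"
    and W: "finite W" "D \<inter> W \<noteq> {}"
  shows "infinite {y. \<forall>n. n + y \<in> W \<longrightarrow> (n \<in> D \<longleftrightarrow> n + y \<in> D)}" (is "infinite ?Y")
proof
  assume fin: "finite ?Y"
  have occ: "card (occurrences D W Z) \<le> card ?Y" for Z
  proof -
    have "occurrences D W Z \<subseteq> (\<lambda>y. {n \<in> D. y + n \<in> W}) ` ?Y"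
    proof
      fix Q assume "Q \<in> occurrences D W Z"
      then obtain y where y: "Q = {n \<in> D. y + n \<in> W}" "(+) y ` Q = D \<inter> W"
        by (auto simp: occurrences_def)
      \<comment> \<open>Both halves of \<open>occurrences\<close> enter: \<open>Q\<close> is all
        that \<open>D\<close> has in the translated window, and its translate misses nothing of
        \<open>D \<inter> W\<close>.\<close>
      have "n \<in> D \<longleftrightarrow> n + y \<in> D" if n: "n + y \<in> W" for n
      proof -
        have W': "y + n \<in> W" using n by (simp add: add.commute)
        have "n \<in> D \<longleftrightarrow> n \<in> Q" using y(1) W' by simp
        also have "\<dots> \<longleftrightarrow> y + n \<in> (+) y ` Q" by auto
        also have "\<dots> \<longleftrightarrow> n + y \<in> D"
          unfolding y(2) using W' by (simp add: add.commute)
        finally show ?thesis .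
      qed
      with y(1) show "Q \<in> (\<lambda>y. {n \<in> D. y + n \<in> W}) ` ?Y" by auto
    qed
    then show ?thesis using fin by (meson card_image_le card_mono finite_imageI le_trans)
  qed
  obtain \<nu> where "uniform_limit UNIV (\<lambda>L x. pattern_freq c D W L x) \<nu> sequentially"
    using freq W unfolding strict_uniform_pattern_frequency_def uniform_pattern_frequency_def
    by blast
  then have lim: "(\<lambda>L. pattern_freq c D W L 0) \<longlonglongrightarrow> \<nu> 0"
    by (rule tendsto_uniform_limitI) simp
  have "lim (\<lambda>L. pattern_freq c D W L 0) > 0"
    using freq W unfolding strict_uniform_pattern_frequency_def by blast
  then have pos: "\<nu> 0 > 0" using limI[OF lim] by simp
  then have "eventually (\<lambda>L. pattern_freq c D W L 0 > \<nu> 0 / 2) sequentially"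
    by (intro order_tendstoD(1)[OF lim]) simp
  then obtain L0 where L0: "\<And>L. L \<ge> L0 \<Longrightarrow> pattern_freq c D W L 0 > \<nu> 0 / 2"
    by (auto simp: eventually_sequentially)
  \<comment> \<open>A cube with at least \<open>m\<close> points is too large for
    \<open>card ?Y\<close> occurrences to give frequency above \<open>\<nu> 0 / 2\<close>. Taking
    \<open>2 * m\<close> as side length offsets the halving in
    \<open>card_lattice_cube_ge\<close>.\<close>
  obtain m :: nat where m: "2 * real (card ?Y) / \<nu> 0 < real m" using reals_Archimedean2 by blast
  define L where "L = max L0 (2 * m)"
  define k where "k = card (lattice_cube c (real L) :: (int ^ 'd) set)"
  have "\<nu> 0 / 2 < real (card (occurrences D W ((+) 0 ` lattice_cube c (real L)))) / real k"
    using L0[of L] by (simp add: L_def pattern_freq_def k_def)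
  also have "\<dots> \<le> real (card ?Y) / real k"
    by (intro divide_right_mono) (simp_all add: occ)
  finally have less: "\<nu> 0 / 2 < real (card ?Y) / real k" .
  \<comment> \<open>Division by 0 yields 0, which contradicts \<open>less\<close>. As infinite sets
    have \<open>card\<close> 0, the cube is then finite.\<close>
  then have "k \<noteq> 0" using pos by (intro notI) simp
  then have "finite (lattice_cube c (real L) :: (int ^ 'd) set)"
    unfolding k_def by (rule card_ge_0_finite[OF neq0_conv[THEN iffD1]])
  then have "L div 2 \<le> k" unfolding k_def by (rule card_lattice_cube_ge)
  moreover have "m \<le> L div 2" unfolding L_def by linarith
  ultimately have "real m \<le> real k" by simp
  moreover have "real k < 2 * real (card ?Y) / \<nu> 0"
    using less pos \<open>k \<noteq> 0\<close> by (simp add: field_simps)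
  ultimately show False using m by simp
qed

section \<open>Absence of discrete spectrum\<close>

text \<open>Gaussian elimination: a pivot \<open>j\<close> in equation \<open>b\<close> is used to
  remove one unknown and one equation; \<open>c'\<close> is the reduced system.\<close>

lemma homogeneous_system_nontrivial_solution:
  fixes c :: "'b \<Rightarrow> 'i \<Rightarrow> 'k::field"
  assumes "finite B" "finite I" "card B < card I"
  shows "\<exists>a. (\<exists>i\<in>I. a i \<noteq> 0) \<and> (\<forall>b\<in>B. (\<Sum>i\<in>I. a i * c b i) = 0)"
  using assms
proof (induction B arbitrary: I c rule: finite_induct)
  case empty
  then have "I \<noteq> {}" by auto
  then show ?case by (intro exI[of _ "\<lambda>_. 1"]) auto
next
  case (insert b B)
  show ?case
  proof (cases "\<forall>i\<in>I. c b i = 0")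
    case True
    with insert.IH[of I c] insert.prems insert.hyps show ?thesis by auto
  next
    case False
    then obtain j where j: "j \<in> I" "c b j \<noteq> 0" by auto
    define c' where "c' b' i = c b' i - c b' j * c b i / c b j" for b' i
    have "card B < card (I - {j})"
      using insert.prems insert.hyps j by auto
    from insert.IH[OF _ this, of c'] insert.prems obtain a
      where a: "\<exists>i\<in>I - {j}. a i \<noteq> 0" "\<forall>b'\<in>B. (\<Sum>i\<in>I - {j}. a i * c' b' i) = 0" by auto
    \<comment> \<open>The value at \<open>j\<close> is forced by equation \<open>b\<close>.\<close>
    define a' where "a' = a(j := - (\<Sum>i\<in>I - {j}. a i * c b i) / c b j)"
    have split: "(\<Sum>i\<in>I. a' i * c b' i) = a' j * c b' j + (\<Sum>i\<in>I - {j}. a i * c b' i)" for b'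
      using insert.prems j
      by (simp add: sum.remove[of I j] a'_def cong: sum.cong_simp)
    have "(\<Sum>i\<in>I. a' i * c b i) = 0"
      using j by (simp add: split) (simp add: a'_def)
    moreover have "(\<Sum>i\<in>I. a' i * c b' i) = 0" if "b' \<in> B" for b'
    proof -
      have "(\<Sum>i\<in>I. a' i * c b' i) = (\<Sum>i\<in>I - {j}. a i * c' b' i)"
        unfolding split by (simp add: a'_def c'_def right_diff_distrib sum_subtractf
            sum_divide_distrib sum_distrib_right sum_distrib_left mult_ac)
      then show ?thesis using a that by simp
    qed
    moreover have "\<exists>i\<in>I. a' i \<noteq> 0" using a by (auto simp: a'_def)
    ultimately show ?thesis by (intro exI[of _ a']) auto
  qed
qed

text \<open>The \<open>k i\<close> outnumber the spanning functions, so some nontrivial combination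
  of them vanishes. The same combination of the \<open>v i\<close> is then one of the differences
  \<open>v i - k i\<close>, and restricting it to the support of a single \<open>v j\<close>
  isolates that term.\<close>

lemma disjoint_supports_far_from_span:
  fixes v k :: "'i \<Rightarrow> 'a l2"
  assumes fin: "finite B" "finite I" "card B < card I"
    and span: "\<And>i. i \<in> I \<Longrightarrow> \<exists>a. l2_apply (k i) = (\<lambda>n. \<Sum>b\<in>B. a b * b n)"
    and disj: "\<And>i j n. i \<in> I \<Longrightarrow> j \<in> I \<Longrightarrow> l2_apply (v i) n \<noteq> 0 \<Longrightarrow> l2_apply (v j) n \<noteq> 0 \<Longrightarrow> i = j"
    and norm_v: "\<And>i. i \<in> I \<Longrightarrow> \<nu> \<le> norm (v i)"
  shows "\<exists>i\<in>I. \<nu> \<le> real (card I) * norm (v i - k i)"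
proof (rule ccontr)
  assume "\<not> ?thesis"
  then have near: "norm (v i - k i) < \<nu> / real (card I)" if "i \<in> I" for i
    using that fin by (auto simp: not_le field_simps)
  obtain c where c: "\<And>i n. i \<in> I \<Longrightarrow> l2_apply (k i) n = (\<Sum>b\<in>B. c i b * b n)"
    using span by metis
  obtain a where a: "\<exists>i\<in>I. a i \<noteq> 0" "\<And>b. b \<in> B \<Longrightarrow> (\<Sum>i\<in>I. a i * c i b) = 0"
    using homogeneous_system_nontrivial_solution[OF fin, of "\<lambda>b i. c i b"] by blast
  have ne: "I \<noteq> {}" using a by auto
  \<comment> \<open>Choosing \<open>j\<close> with the largest coefficient lets
    \<open>cmod (a j)\<close> bound all the others and drop out of the final estimate.\<close>
  have "Max ((\<lambda>i. cmod (a i)) ` I) \<in> (\<lambda>i. cmod (a i)) ` I"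
    using fin ne by (intro Max_in) auto
  then obtain j where j: "j \<in> I" "Max ((\<lambda>i. cmod (a i)) ` I) = cmod (a j)" by auto
  have le: "cmod (a i) \<le> cmod (a j)" if "i \<in> I" for i
    using Max_ge[of "(\<lambda>i. cmod (a i)) ` I" "cmod (a i)"] fin that j by auto
  with a(1) have pos: "cmod (a j) > 0" by fastforce
  define S where "S = {n. l2_apply (v j) n \<noteq> 0}"
  have "(\<Sum>i\<in>I. cscale_l2 (a i) (k i)) = 0"
  proof (rule l2_eqI)
    fix n
    have "l2_apply (\<Sum>i\<in>I. cscale_l2 (a i) (k i)) n = (\<Sum>i\<in>I. \<Sum>b\<in>B. a i * c i b * b n)"
      by (simp add: l2_reps c sum_distrib_left mult.assoc)
    also have "\<dots> = (\<Sum>b\<in>B. (\<Sum>i\<in>I. a i * c i b) * b n)"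
      by (subst sum.swap) (simp add: sum_distrib_right)
    finally show "l2_apply (\<Sum>i\<in>I. cscale_l2 (a i) (k i)) n = l2_apply 0 n"
      by (simp add: a(2) l2_reps)
  qed
  moreover have "(\<Sum>i\<in>I. cscale_l2 (a i) (v i - k i))
      = (\<Sum>i\<in>I. cscale_l2 (a i) (v i)) - (\<Sum>i\<in>I. cscale_l2 (a i) (k i))"
    by (rule l2_eqI) (simp add: l2_reps right_diff_distrib sum_subtractf)
  ultimately have diff: "(\<Sum>i\<in>I. cscale_l2 (a i) (v i - k i)) = (\<Sum>i\<in>I. cscale_l2 (a i) (v i))"
    by simp
  have restrict: "restrict_l2 S (\<Sum>i\<in>I. cscale_l2 (a i) (v i)) = cscale_l2 (a j) (v j)"
  proof (rule l2_eqI)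
    fix n
    have "(\<Sum>i\<in>I. a i * l2_apply (v i) n) = a j * l2_apply (v j) n" if "n \<in> S"
    proof -
      have "a i * l2_apply (v i) n = 0" if "i \<in> I - {j}" for i
        using disj[of i j n] that \<open>n \<in> S\<close> j(1) by (auto simp: S_def)
      then have "(\<Sum>i\<in>I - {j}. a i * l2_apply (v i) n) = 0" by (rule sum.neutral[OF ballI])
      then show ?thesis using fin j(1) by (simp add: sum.remove[of I j])
    qed
    then show "l2_apply (restrict_l2 S (\<Sum>i\<in>I. cscale_l2 (a i) (v i))) n = l2_apply (cscale_l2 (a j) (v j)) n"
      by (cases "n \<in> S") (auto simp: l2_reps S_def)
  qed
  have "cmod (a j) * \<nu> \<le> norm (cscale_l2 (a j) (v j))"
    using norm_v[OF j(1)] by (simp add: norm_cscale_l2 mult_left_mono)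
  also have "\<dots> \<le> norm (\<Sum>i\<in>I. cscale_l2 (a i) (v i - k i))"
    unfolding diff restrict[symmetric] by (rule norm_restrict_l2_le)
  also have "\<dots> \<le> (\<Sum>i\<in>I. norm (cscale_l2 (a i) (v i - k i)))"
    by (rule norm_sum)
  also have "\<dots> \<le> (\<Sum>i\<in>I. cmod (a j) * norm (v i - k i))"
    by (intro sum_mono) (simp add: norm_cscale_l2 mult_right_mono le)
  also have "\<dots> < (\<Sum>i\<in>I. cmod (a j) * (\<nu> / real (card I)))"
    using fin ne pos near by (intro sum_strict_mono mult_strict_left_mono) auto
  also have "\<dots> = cmod (a j) * \<nu>"
    using fin ne by simp
  finally show False by simp
qed

section \<open>Contradiction from an isolated eigenvalue of finite multiplicity\<close>

theorem proposition3p3: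
  fixes D :: "(int ^ 'd::finite) set" and M R :: real and c :: "real ^ 'd"
  assumes "M > 0"
    and "R \<ge> 1"
    and "delone_set R D"
    and "strict_uniform_pattern_frequency c D"
  shows "op_spectrum (H0_tilde D M) = essential_spectrum (H0_tilde D M)"
proof -
  let ?H = "H0_l2 D M"
  have False if discrete: "z \<in> discrete_spectrum (H0_tilde D M)" for z
  proof -
    obtain u where u: "u \<in> eigenspace (H0_tilde D M) z" "u \<noteq> (\<lambda>n. 0)"
      using discrete unfolding discrete_spectrum_def by blast
    have "finite_dim (eigenspace (H0_tilde D M) z)"
      using discrete unfolding discrete_spectrum_def by blast
    then obtain B where B: "finite B"
      "\<forall>v\<in>eigenspace (H0_tilde D M) z. \<exists>a. v = (\<lambda>n. \<Sum>b\<in>B. a b * b n)"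
      unfolding finite_dim_def by blast
    have "z isolated_in op_spectrum (H0_tilde D M)"
      using discrete unfolding discrete_spectrum_def by blast
    then obtain e where e: "e > 0"
      "\<And>w. w \<in> op_spectrum (H0_tilde D M) \<Longrightarrow> dist z w < e \<Longrightarrow> w = z"
      unfolding isolated_in_dist_Ex_iff by blast
    define x where "x = l2_abs u"
    have x: "l2_apply x = u"
      using u(1) by (simp add: x_def eigenspace_def l2_abs_inverse)
    then have "?H x = cscale_l2 z x"
      using u(1) by (intro l2_eqI) (simp add: l2_apply_H0_l2 cscale_l2.rep_eq eigenspace_def)
    moreover have "x \<noteq> 0" using x u(2) by (auto simp: zero_l2.rep_eq)
    ultimately obtain \<mu> where z: "z = complex_of_real \<mu>" and Hx: "?H x = cscale_l2 z x"
      using H0_l2_eigenvalue_real by blast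
    \<comment> \<open>As the eigenvalue is real, the shift preserves symmetry; it moves the gap to 0
      and makes the kernel the eigenspace.\<close>
    define A where "A y = ?H y - \<mu> *\<^sub>R y" for y
    have lin: "bounded_linear A"
      unfolding A_def
      by (intro bounded_linear_sub bounded_linear_H0_l2 bounded_linear_scaleR_right)
    interpret A: bounded_linear A by (rule lin)
    have sym: "inner (A y) w = inner y (A w)" for y w
      by (simp add: A_def inner_diff_left inner_diff_right H0_l2_symmetric)
    have kernel: "l2_apply y \<in> eigenspace (H0_tilde D M) z" if "A y = 0" for y
    proof -
      have "?H y = \<mu> *\<^sub>R y" using that by (simp add: A_def)
      then have "H0_tilde D M (l2_apply y) = (\<lambda>n. z * l2_apply y n)"
        by (simp add: l2_apply_H0_l2[symmetric] scaleR_l2.rep_eq z scaleR_conv_of_real)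
      then show ?thesis using l2_apply by (simp add: eigenspace_def)
    qed
    \<comment> \<open>Thus \<open>2 * r = e\<close>, and the punctured interval of the gap lemmas
      lies in the punctured disc around \<open>z\<close> that is free of spectrum.\<close>
    define r where "r = e / 2"
    have "r > 0" using e(1) by (simp add: r_def)
    have resolvent: "complex_of_real (\<mu> + t) \<in> resolvent_set (H0_tilde D M)"
      if "t \<noteq> 0" "\<bar>t\<bar> < 2 * r" for t
    proof -
      have "dist z (complex_of_real (\<mu> + t)) < e"
        using that by (simp add: z dist_norm r_def)
      then show ?thesis using e(2)[of "complex_of_real (\<mu> + t)"] that
        by (auto simp: op_spectrum_def z)
    qed
    have shift_eq: "A y - t *\<^sub>R y = ?H y - (\<mu> + t) *\<^sub>R y" for y t
      by (simp add: A_def algebra_simps)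
    have below: "\<exists>\<kappa>>0. \<forall>y. \<kappa> * norm y \<le> norm (A y - t *\<^sub>R y)" if "t \<noteq> 0" "\<bar>t\<bar> < 2 * r" for t
      unfolding shift_eq by (rule resolvent_set_l2(1)[OF resolvent[OF that] l2_apply_H0_l2])
    have onto: "surj (\<lambda>y. A y - t *\<^sub>R y)" if "t \<noteq> 0" "\<bar>t\<bar> < 2 * r" for t
      unfolding shift_eq by (rule resolvent_set_l2(2)[OF resolvent[OF that] l2_apply_H0_l2])
    obtain C where C: "C > 0" "\<And>y. norm (A y) \<le> norm y * C"
      using A.pos_bounded by blast
    \<comment> \<open>The constants are read off the final estimate: truncation loses less than
      \<open>\<delta>\<close> of the norm, and \<open>N\<close> kernel approximations cost
      \<open>N * \<delta> * C / r\<close>. With this \<open>s\<close> both together are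
      \<open>\<delta> * s / r\<close>, half of \<open>norm x\<close>.\<close>
    define N where "N = Suc (card B)"
    define s where "s = real N * C + r"
    define \<delta> where "\<delta> = norm x / 2 * (r / s)"
    have "s > 0" using C(1) \<open>r > 0\<close> by (simp add: s_def add_nonneg_pos)
    then have "\<delta> > 0" using \<open>x \<noteq> 0\<close> \<open>r > 0\<close> by (simp add: \<delta>_def)
    obtain K where K: "finite K" "norm (x - restrict_l2 K x) < \<delta>"
      using l2_truncation[OF \<open>\<delta> > 0\<close>] by blast
    define v where "v = restrict_l2 K x"
    have v_supp: "n \<in> K" if "l2_apply v n \<noteq> 0" for n
      using that by (auto simp: v_def restrict_l2.rep_eq indicator_def split: if_splits)
    have "A x = 0"
      unfolding A_def Hx by (rule l2_eqI) (simp add: l2_reps z scaleR_conv_of_real)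
    then have "norm (A v) = norm (A (x - v))" by (simp add: A.diff)
    also have "\<dots> \<le> \<delta> * C"
      using C(2)[of "x - v"] K(2) C(1) by (auto simp: v_def intro: order_trans mult_right_mono)
    finally have Av: "norm (A v) \<le> \<delta> * C" .
    define \<eta> where "\<eta> = real N * (\<delta> * C / r)"
    have "norm x - \<delta> \<le> norm v"
      using K(2) norm_triangle_ineq2[of x v] by (simp add: v_def)
    moreover have "\<eta> + \<delta> = norm x / 2"
    proof -
      have "\<eta> + \<delta> = \<delta> * s / r"
        using \<open>r > 0\<close> by (simp add: \<eta>_def s_def field_simps)
      also have "\<dots> = norm x / 2"
        using \<open>s > 0\<close> \<open>r > 0\<close> by (simp add: \<delta>_def)
      finally show ?thesis .
    qed
    moreover have "norm x > 0" using \<open>x \<noteq> 0\<close> by simp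
    ultimately have small: "\<eta> < norm v"
      by linarith
    \<comment> \<open>The frequency hypothesis speaks of nonempty patterns only, and
      \<open>K\<close> may miss \<open>D\<close>; a point of \<open>D\<close> is therefore added to
      the window.\<close>
    obtain p where "p \<in> D" using assms(3) by (auto simp: delone_set_def)
    let ?W = "insert p K"
    have "infinite {y. \<forall>n. n + y \<in> ?W \<longrightarrow> (n \<in> D \<longleftrightarrow> n + y \<in> D)}"
      using K(1) \<open>p \<in> D\<close> by (intro infinite_pattern_translations[OF assms(4)]) auto
    from infinite_disjoint_translates[OF this K(1), of N] obtain F
      where F: "F \<subseteq> {y. \<forall>n. n + y \<in> ?W \<longrightarrow> (n \<in> D \<longleftrightarrow> n + y \<in> D)}" "finite F" "card F = N"
        and disj: "\<And>y y' n. y \<in> F \<Longrightarrow> y' \<in> F \<Longrightarrow> n + y \<in> K \<Longrightarrow> n + y' \<in> K \<Longrightarrow> y = y'"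
      by blast
    have "norm (A (shift_l2 y v)) = norm (A v)" if "y \<in> F" for y
    proof -
      interpret S: bounded_linear "shift_l2 y" by (rule bounded_linear_shift_l2)
      have "?H (shift_l2 y v) = shift_l2 y (?H v)"
        using F(1) that v_supp by (intro H0_l2_shift) blast
      then show ?thesis
        by (simp add: A_def S.scaleR[symmetric] S.diff[symmetric] norm_shift_l2)
    qed
    \<comment> \<open>Every translate is as good an approximate kernel vector as \<open>v\<close>,
      so one error bound serves for all of them.\<close>
    then have "\<exists>w. A w = 0 \<and> norm (shift_l2 y v - w) \<le> norm (A v) / r" if "y \<in> F" for y
      using symmetric_gap_near_kernel[OF lin sym \<open>r > 0\<close> below onto, of "shift_l2 y v"] that
      by metis
    then obtain k where k: "\<And>y. y \<in> F \<Longrightarrow> A (k y) = 0"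
      "\<And>y. y \<in> F \<Longrightarrow> norm (shift_l2 y v - k y) \<le> norm (A v) / r"
      by metis
    have "\<exists>y\<in>F. norm v \<le> real (card F) * norm (shift_l2 y v - k y)"
    proof (rule disjoint_supports_far_from_span[OF B(1) F(2)])
      show "card B < card F" by (simp add: F N_def)
      show "\<exists>a. l2_apply (k y) = (\<lambda>n. \<Sum>b\<in>B. a b * b n)" if "y \<in> F" for y
        using B(2) kernel k(1)[OF that] by blast
      show "y = y'" if "y \<in> F" "y' \<in> F" "l2_apply (shift_l2 y v) n \<noteq> 0"
        "l2_apply (shift_l2 y' v) n \<noteq> 0" for y y' n
        using disj[OF that(1,2)] that(3,4) v_supp unfolding shift_l2.rep_eq by blast
    qed (simp add: norm_shift_l2)
    then obtain y where y: "y \<in> F" "norm v \<le> real N * norm (shift_l2 y v - k y)"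
      using F(3) by auto
    note y(2)
    also have "real N * norm (shift_l2 y v - k y) \<le> \<eta>"
      unfolding \<eta>_def using k(2)[OF y(1)] Av \<open>r > 0\<close>
      by (intro mult_left_mono order_trans[OF k(2)[OF y(1)]] divide_right_mono) auto
    finally show False using small by simp
  qed
  then show ?thesis unfolding essential_spectrum_def by blast
qed

end
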